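(* Let $\psi(x,t)\ge 0$ satisfy the linear problem $$\frac{\partial \psi}{\partial t} = D\frac{\partial^2\psi}{\partial x^2}+f'(0)\psi \quad\text{in } A(t)<x<A(t)+L(t),\qquad \psi(x,t)=0 \ \text{ at } x=A(t) \text{ and } x=A(t)+L(t),$$ and let $u(\xi,t)$ and $w(\xi,t)$ ($0\le \xi\le L_0$) be the functions obtained from $\psi$ by the changes of variables given in the context. Suppose that $$b\sin\left(\frac{\pi\xi}{L_0}\right)\le w(\xi,0)\le a\sin\left(\frac{\pi\xi}{L_0}\right)\quad\text{for } 0\le\xi\le L_0,$$ for some constants $0<b\le a$. Then for all $t\ge 0$ and all $0\le\xi\le L_0$ we have $$u(\xi,t)\ge b\sin\left(\frac{\pi\xi}{L_0}\right)\left(\frac{L_0}{L(t)}\right)^{1/2}\exp\left(f'(0)t-\int_0^t\frac{\dot A(\zeta)^2}{4D}\,d\zeta\right)\exp\left(\int_0^t\left(-\frac{D\pi^2}{L(\zeta)^2}-\frac{\underline{Q}(\zeta)}{2D}\right)d\zeta-\frac{\xi^2\dot L(t)L(t)}{4DL_0^2}-\frac{\xi\dot A(t)L(t)}{2DL_0}\right)$$ and $$u(\xi,t)\le a\sin\left(\frac{\pi\xi}{L_0}\right)\left(\frac{L_0}{L(t)}\right)^{1/2}\exp\left(f'(0)t-\int_0^t\frac{\dot A(\zeta)^2}{4D}\,d\zeta\right)\exp\left(\int_0^t\left(-\frac{D\pi^2}{L(\zeta)^2}+\frac{\overline{Q}(\zeta)}{2D}\right)d\zeta-\frac{\xi^2\dot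 L(t)L(t)}{4DL_0^2}-\frac{\xi\dot A(t)L(t)}{2DL_0}\right).$$
   Context: Here $D>0$ and $f'(0)>0$ are constants (the reaction term is the linear function $f(\psi)=f'(0)\psi$). The functions $A(t)$ and $L(t)$ are prescribed real-valued functions of $t\ge 0$, twice continuously differentiable, with $L(t)>0$ for all $t\ge 0$; dots denote derivatives with respect to $t$. Solutions $\psi$ are non-negative, and the problem is posed for $t\ge0$. Fix a constant $L_0>0$. Define $u$ on $0\le\xi\le L_0$ by $\psi(x,t)=u(\xi,t)$ where $\xi=\frac{x-A(t)}{L(t)}L_0$. Define $$w(\xi,t)=u(\xi,t)\left(\frac{L(t)}{L_0}\right)^{1/2}\exp\left(-f'(0)t+\int_0^t\frac{\dot A(\zeta)^2}{4D}\,d\zeta\right)\exp\left(\frac{\xi^2\dot L(t)L(t)}{4DL_0^2}+\frac{\xi\dot A(t)L(t)}{2DL_0}\right).$$ The non-negative functions $\overline{Q}$ and $\underline{Q}$ are $$\overline{Q}(t)=\max_{0\le\eta\le1}\left(\frac{\eta^2\ddot L(t)L(t)}{2}+\eta\ddot A(t)L(t)\right),\qquad \underline{Q}(t)=-\min_{0\le\eta\le1}\left(\frac{\eta^2\ddot L(t)L(t)}{2}+\eta\ddot A(t)L(t)\right).$$ *)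

theory Defs
  imports "HOL-Analysis.Analysis"
begin

text \<open>\<open>f\<close> is twice continuously differentiable on \<open>[0, \<infinity>)\<close> with first and second derivatives
  \<open>f1\<close>, \<open>f2\<close> (one-sided derivatives at \<open>0\<close>).\<close>

definition C2_on_halfline :: "(real \<Rightarrow> real) \<Rightarrow> (real \<Rightarrow> real) \<Rightarrow> (real \<Rightarrow> real) \<Rightarrow> bool" where
  "C2_on_halfline f f1 f2 \<longleftrightarrow>
     (\<forall>t\<ge>0. (f has_real_derivative f1 t) (at t within {0..})) \<and>
     (\<forall>t\<ge>0. (f1 has_real_derivative f2 t) (at t within {0..})) \<and>
     continuous_on {0..} f2"

text \<open>Classical solutions, in the arguments \<open>\<psi> x t\<close>, of \<open>\<psi>\<^sub>t = D \<psi>\<^sub>x\<^sub>x + r \<psi>\<close> with zero Dirichlet data on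
  the moving interval \<open>[A(t), A(t) + L(t)]\<close>. The function is continuous up to the lateral boundary and
  to the initial time, and the equation holds pointwise for \<open>t > 0\<close>. Continuity of the partial
  derivatives is not required. The domain is open in the region \<open>t > 0\<close>, so the values of \<open>\<psi>\<close>
  outside it do not matter.\<close>

definition linear_dirichlet_solution ::
  "real \<Rightarrow> real \<Rightarrow> (real \<Rightarrow> real) \<Rightarrow> (real \<Rightarrow> real) \<Rightarrow> (real \<Rightarrow> real \<Rightarrow> real) \<Rightarrow> bool" where
  "linear_dirichlet_solution D r A L \<psi> \<longleftrightarrow>
     continuous_on {(x, t). 0 \<le> t \<and> A t \<le> x \<and> x \<le> A t + L t} (\<lambda>(x, t). \<psi> x t) \<and>
     (\<exists>\<psi>t \<psi>x \<psi>xx. \<forall>t>0. \<forall>x\<in>{A t<..<A t + L t}.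
        ((\<lambda>s. \<psi> x s) has_real_derivative \<psi>t x t) (at t) \<and>
        ((\<lambda>y. \<psi> y t) has_real_derivative \<psi>x x t) (at x) \<and>
        ((\<lambda>y. \<psi>x y t) has_real_derivative \<psi>xx x t) (at x) \<and>
        \<psi>t x t = D * \<psi>xx x t + r * \<psi> x t) \<and>
     (\<forall>t\<ge>0. \<psi> (A t) t = 0 \<and> \<psi> (A t + L t) t = 0)"

text \<open>Below, \<open>A1\<close>, \<open>A2\<close>, \<open>L1\<close>, \<open>L2\<close> stand for the first and second time derivatives of \<open>A\<close> and
  \<open>L\<close>, and \<open>r\<close> for \<open>f'(0)\<close>.\<close>

definition w_transform ::
  "real \<Rightarrow> real \<Rightarrow> real \<Rightarrow> (real \<Rightarrow> real) \<Rightarrow> (real \<Rightarrow> real) \<Rightarrow> (real \<Rightarrow> real) \<Rightarrow>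
   (real \<Rightarrow> real \<Rightarrow> real) \<Rightarrow> real \<Rightarrow> real \<Rightarrow> real" where
  "w_transform D r L0 A1 L L1 u \<xi> t =
     u \<xi> t * sqrt (L t / L0)
     * exp (- r * t + integral {0..t} (\<lambda>\<zeta>. (A1 \<zeta>)\<^sup>2 / (4 * D)))
     * exp (\<xi>\<^sup>2 * L1 t * L t / (4 * D * L0\<^sup>2) + \<xi> * A1 t * L t / (2 * D * L0))"

text \<open>The extrema over \<open>0 \<le> \<eta> \<le> 1\<close> are of a continuous function on a compact interval, so
  \<open>SUP\<close> and \<open>INF\<close> are attained.\<close>

definition Q_upper ::
  "(real \<Rightarrow> real) \<Rightarrow> (real \<Rightarrow> real) \<Rightarrow> (real \<Rightarrow> real) \<Rightarrow> real \<Rightarrow> real" where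
  "Q_upper A2 L L2 t = (SUP \<eta>\<in>{0..1}. \<eta>\<^sup>2 * L2 t * L t / 2 + \<eta> * A2 t * L t)"

definition Q_lower ::
  "(real \<Rightarrow> real) \<Rightarrow> (real \<Rightarrow> real) \<Rightarrow> (real \<Rightarrow> real) \<Rightarrow> real \<Rightarrow> real" where
  "Q_lower A2 L L2 t = - (INF \<eta>\<in>{0..1}. \<eta>\<^sup>2 * L2 t * L t / 2 + \<eta> * A2 t * L t)"

end

theory Submission imports Defs begin

text \<open>
  Both bounds compare \<open>\<psi>\<close> with one explicit barrier by a parabolic maximum principle, directly in
  the variables \<open>(x, t)\<close>. Undoing the changes of variables in a separated function
  \<open>sin (\<pi>\<xi>/L0) exp (\<integral> (- D\<pi>\<^sup>2/L\<^sup>2 + q/(2D)))\<close> for \<open>w\<close> gives, with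
  \<open>\<eta> = (x - A(t))/L(t) = \<xi>/L0\<close>, a barrier \<open>\<Phi>\<^sub>q\<close> that satisfies
  \<open>\<partial>\<^sub>t\<Phi>\<^sub>q = D \<partial>\<^sub>x\<partial>\<^sub>x\<Phi>\<^sub>q + r \<Phi>\<^sub>q + (q(t) - F(\<eta>, t))/(2D) \<Phi>\<^sub>q\<close>, where
  \<open>F(\<eta>, t) = \<eta>\<^sup>2 L2 L/2 + \<eta> A2 L\<close>
  (lemma \<open>barrier_pde\<close>). It vanishes on the lateral boundary and is non-negative in between. As
  \<open>- Q_lower \<le> F \<le> Q_upper\<close> for \<open>0 \<le> \<eta> \<le> 1\<close>, taking \<open>q = Q_upper\<close> gives a supersolution and
  \<open>q = - Q_lower\<close> a subsolution of the equation for \<open>\<psi>\<close>. The hypothesis on \<open>w\<close> at time \<open>0\<close> says that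
  \<open>b \<Phi>\<^sub>q \<le> \<psi> \<le> a \<Phi>\<^sub>q\<close> there, whatever \<open>q\<close> is, and the maximum principle propagates each half of
  this to all later times.

  The partial derivatives of \<open>\<psi>\<close> are only assumed to exist separately, so the chain rule need not
  hold for \<open>u(\<xi>, t) = \<psi>(A + \<xi> L/L0, t)\<close> as a function of \<open>t\<close>. This is why the comparison is carried
  out on the moving interval and not on \<open>[0, L0]\<close>: the lemma
  \<open>weak_maximum_principle_moving_interval\<close> uses no more than separate derivatives. The barrier must
  itself be differentiable in \<open>t\<close>, and for this \<open>Q_upper\<close> and \<open>Q_lower\<close> have to be continuous
  (lemma \<open>continuous_on_SUP_quadratic\<close>).
\<close>

section \<open>A weak maximum principle on a moving interval\<close>

lemma deriv2_nonpos_at_local_max: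
  fixes f f' :: "real \<Rightarrow> real"
  assumes ab: "a < x" "x < b"
    and f': "\<And>y. a < y \<Longrightarrow> y < b \<Longrightarrow> (f has_real_derivative f' y) (at y)"
    and f'': "(f' has_real_derivative c) (at x)"
    and mx: "\<And>y. a < y \<Longrightarrow> y < b \<Longrightarrow> f y \<le> f x"
  shows "c \<le> 0"
proof (rule ccontr)
  assume "\<not> c \<le> 0"
  then have "c > 0" by simp
  have "f' x = 0"
  proof (rule DERIV_local_max[of f "f' x" x "min (x - a) (b - x)"])
    show "\<forall>y. \<bar>x - y\<bar> < min (x - a) (b - x) \<longrightarrow> f y \<le> f x"
      using mx by (auto simp: abs_less_iff)
  qed (use ab f' in auto)
  with DERIV_pos_inc_right[OF f'' \<open>c > 0\<close>]
  obtain d where d: "d > 0" "\<And>h. 0 < h \<Longrightarrow> h < d \<Longrightarrow> 0 < f' (x + h)"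
    by auto
  \<comment> \<open>If \<open>c > 0\<close>, then \<open>f'\<close> is positive just to the right of its zero \<open>x\<close>, so \<open>f\<close> exceeds \<open>f x\<close> there.\<close>
  define h where "h = min d (b - x) / 2"
  have h: "0 < h" "h < d" "x + h < b"
    using d(1) ab by (auto simp: h_def min_def field_simps)
  obtain z where z: "x < z" "z < x + h" "f (x + h) - f x = (x + h - x) * f' z"
    using MVT2[of x "x + h" f f'] f' ab h by force
  have "0 < f' (x + (z - x))"
    using z h by (intro d(2)) auto
  then have "f (x + h) > f x"
    using z(3) h(1) by (simp add: algebra_simps mult_pos_pos)
  moreover have "f (x + h) \<le> f x"
    using mx ab h by simp
  ultimately show False by simp
qed

lemma compact_between_graphs:
  fixes \<alpha> \<beta> :: "real \<Rightarrow> real"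
  assumes "continuous_on {0..T} \<alpha>" and "continuous_on {0..T} \<beta>"
  shows "compact {(x, t). t \<in> {0..T} \<and> \<alpha> t \<le> x \<and> x \<le> \<beta> t}"
proof -
  \<comment> \<open>The region is a continuous image of a compact set of pairs \<open>(s, t)\<close>, where \<open>s\<close> interpolates
    linearly between the two graphs. Times with \<open>\<alpha> t > \<beta> t\<close> contribute no points.\<close>
  let ?h = "\<lambda>(s::real, t). (\<alpha> t + s * (\<beta> t - \<alpha> t), t)"
  let ?K = "{0..1::real} \<times> {t\<in>{0..T}. \<alpha> t \<le> \<beta> t}"
  have "closed {t\<in>{0..T}. \<alpha> t \<le> \<beta> t}"
    using continuous_on_closed_Collect_le[OF assms] by simp
  then have "compact ({0..T} \<inter> {t\<in>{0..T}. \<alpha> t \<le> \<beta> t})"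
    by (intro compact_Int_closed) auto
  moreover have "{0..T} \<inter> {t\<in>{0..T}. \<alpha> t \<le> \<beta> t} = {t\<in>{0..T}. \<alpha> t \<le> \<beta> t}"
    by auto
  ultimately have "compact {t\<in>{0..T}. \<alpha> t \<le> \<beta> t}"
    by simp
  then have K: "compact ?K"
    by (intro compact_Times compact_Icc)
  have "continuous_on ?K ?h"
    unfolding case_prod_beta
    by (intro continuous_intros continuous_on_compose2[OF assms(1)] continuous_on_compose2[OF assms(2)])
       auto
  then have "compact (?h ` ?K)"
    using K by (rule compact_continuous_image)
  moreover have "?h ` ?K = {(x, t). t \<in> {0..T} \<and> \<alpha> t \<le> x \<and> x \<le> \<beta> t}"
  proof (intro equalityI subsetI)
    fix p assume "p \<in> ?h ` ?K"
    then obtain z where z: "p = ?h z" "z \<in> ?K" by blast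
    obtain s t where "z = (s, t)" by (cases z)
    with z have st: "p = (\<alpha> t + s * (\<beta> t - \<alpha> t), t)" "0 \<le> s" "s \<le> 1" "t \<in> {0..T}" "\<alpha> t \<le> \<beta> t"
      by simp_all
    have "0 \<le> s * (\<beta> t - \<alpha> t)" "s * (\<beta> t - \<alpha> t) \<le> \<beta> t - \<alpha> t"
      using st by (auto intro: mult_left_le_one_le)
    then show "p \<in> {(x, t). t \<in> {0..T} \<and> \<alpha> t \<le> x \<and> x \<le> \<beta> t}"
      using st by auto
  next
    fix p assume "p \<in> {(x, t). t \<in> {0..T} \<and> \<alpha> t \<le> x \<and> x \<le> \<beta> t}"
    then obtain x t where p: "p = (x, t)" "t \<in> {0..T}" "\<alpha> t \<le> x" "x \<le> \<beta> t" by auto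
    define s where "s = (if \<alpha> t = \<beta> t then 0 else (x - \<alpha> t) / (\<beta> t - \<alpha> t))"
    have eq: "?h (s, t) = p" and mem: "(s, t) \<in> ?K"
      using p by (auto simp: s_def divide_le_eq_1)
    show "p \<in> ?h ` ?K" by (rule image_eqI[where f = ?h, OF eq[symmetric] mem])
  qed
  ultimately show ?thesis by simp
qed

text \<open>A subsolution that is nonpositive on the parabolic boundary is nonpositive. There is no sign
  condition on \<open>r\<close>: the factor \<open>exp (- (r + 1) t)\<close> turns the coefficient of the zeroth-order term
  into \<open>- 1\<close>, so that the weighted function decreases strictly in time at a positive maximum.\<close>

lemma weak_maximum_principle_moving_interval:
  fixes \<alpha> \<beta> :: "real \<Rightarrow> real" and v :: "real \<Rightarrow> real \<Rightarrow> real"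
  assumes "D \<ge> 0"
    and cont: "continuous_on {0..} \<alpha>" "continuous_on {0..} \<beta>"
    and cv: "continuous_on {(x, t). 0 \<le> t \<and> \<alpha> t \<le> x \<and> x \<le> \<beta> t} (\<lambda>(x, t). v x t)"
    and init: "\<And>x. \<alpha> 0 \<le> x \<Longrightarrow> x \<le> \<beta> 0 \<Longrightarrow> v x 0 \<le> 0"
    and lat: "\<And>t. 0 \<le> t \<Longrightarrow> v (\<alpha> t) t \<le> 0 \<and> v (\<beta> t) t \<le> 0"
    and vt: "\<And>x t. 0 < t \<Longrightarrow> \<alpha> t < x \<Longrightarrow> x < \<beta> t \<Longrightarrow>
      ((\<lambda>s. v x s) has_real_derivative vt x t) (at t)"
    and vx: "\<And>x t. 0 < t \<Longrightarrow> \<alpha> t < x \<Longrightarrow> x < \<beta> t \<Longrightarrow>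
      ((\<lambda>y. v y t) has_real_derivative vx x t) (at x)"
    and vxx: "\<And>x t. 0 < t \<Longrightarrow> \<alpha> t < x \<Longrightarrow> x < \<beta> t \<Longrightarrow>
      ((\<lambda>y. vx y t) has_real_derivative vxx x t) (at x)"
    and sub: "\<And>x t. 0 < t \<Longrightarrow> \<alpha> t < x \<Longrightarrow> x < \<beta> t \<Longrightarrow>
      vt x t \<le> D * vxx x t + r * v x t"
    and xT: "0 \<le> T" "\<alpha> T \<le> x\<^sub>0" "x\<^sub>0 \<le> \<beta> T"
  shows "v x\<^sub>0 T \<le> 0"
proof (rule ccontr)
  assume "\<not> v x\<^sub>0 T \<le> 0"
  then have pos: "v x\<^sub>0 T > 0" by simp
  define V where "V x t = exp (- (r + 1) * t) * v x t" for x t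
  define \<Omega> where "\<Omega> = {(x, t). t \<in> {0..T} \<and> \<alpha> t \<le> x \<and> x \<le> \<beta> t}"
  have "compact \<Omega>"
    unfolding \<Omega>_def
    by (intro compact_between_graphs continuous_on_subset[OF cont(1)] continuous_on_subset[OF cont(2)]) auto
  moreover have "continuous_on \<Omega> (\<lambda>p. v (fst p) (snd p))"
    using cv unfolding case_prod_beta
    by (rule continuous_on_subset) (auto simp: \<Omega>_def)
  then have "continuous_on \<Omega> (\<lambda>p. V (fst p) (snd p))"
    unfolding V_def by (intro continuous_intros)
  moreover have "(x\<^sub>0, T) \<in> \<Omega>"
    using xT by (simp add: \<Omega>_def)
  ultimately obtain p where p: "p \<in> \<Omega>" "\<And>q. q \<in> \<Omega> \<Longrightarrow> V (fst q) (snd q) \<le> V (fst p) (snd p)"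
    using continuous_attains_sup[of \<Omega> "\<lambda>p. V (fst p) (snd p)"] by blast
  obtain x t where [simp]: "p = (x, t)" by (cases p)
  have mx: "V y s \<le> V x t" if "0 \<le> s" "s \<le> T" "\<alpha> s \<le> y" "y \<le> \<beta> s" for y s
    using p(2)[of "(y, s)"] that by (simp add: \<Omega>_def)
  have "V x\<^sub>0 T > 0" using pos by (simp add: V_def)
  with mx[of T x\<^sub>0] xT have "V x t > 0" by auto
  then have vpos: "v x t > 0" by (simp add: V_def zero_less_mult_iff)
  have tx: "0 \<le> t" "t \<le> T" "\<alpha> t \<le> x" "x \<le> \<beta> t"
    using p(1) by (auto simp: \<Omega>_def)
  have "t \<noteq> 0" using vpos init[of x] tx by force
  then have t: "t > 0" using tx by simp
  have x: "\<alpha> t < x" "x < \<beta> t"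
    using vpos lat[OF tx(1)] tx by (metis less_eq_real_def not_less)+
  have "vxx x t \<le> 0"
  proof (rule deriv2_nonpos_at_local_max[OF x])
    show "v y t \<le> v x t" if "\<alpha> t < y" "y < \<beta> t" for y
      using mx[of t y] that tx by (simp add: V_def)
  qed (use vx vxx t x in auto)
  then have "D * vxx x t \<le> 0" using \<open>D \<ge> 0\<close> by (simp add: mult_nonneg_nonpos)
  then have "vt x t - (r + 1) * v x t < 0"
    using sub[OF t x] vpos by (simp add: algebra_simps)
  then have neg: "exp (- (r + 1) * t) * (vt x t - (r + 1) * v x t) < 0"
    by (simp add: mult_pos_neg)
  have "((\<lambda>s. V x s) has_real_derivative exp (- (r + 1) * t) * (vt x t - (r + 1) * v x t)) (at t)"
    unfolding V_def by (rule derivative_eq_intros vt t x refl | simp add: algebra_simps)+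
  \<comment> \<open>The maximum is over times up to \<open>T\<close> and may be attained at \<open>T\<close> itself, so the contradiction is
    sought at a slightly earlier time \<open>s\<close>, at which \<open>x\<close> is still inside the moving interval.\<close>
  from DERIV_neg_dec_left[OF this neg]
  obtain d where d: "d > 0" "\<And>h. 0 < h \<Longrightarrow> h < d \<Longrightarrow> V x t < V x (t - h)" by auto
  have "isCont \<alpha> t" "isCont \<beta> t"
    using cont t by (auto intro!: continuous_on_interior)
  then have "eventually (\<lambda>s. \<alpha> s < x) (at t)" "eventually (\<lambda>s. x < \<beta> s) (at t)"
    using x by (auto simp: isCont_def intro: order_tendstoD)
  moreover have "eventually (\<lambda>s. dist s t < min d t) (at t)"
    using d t unfolding eventually_at by (intro exI[of _ "min d t"]) auto
  ultimately have "eventually (\<lambda>s. \<alpha> s < x \<and> x < \<beta> s \<and> dist s t < min d t) (at t)"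
    by eventually_elim auto
  then have "eventually (\<lambda>s. \<alpha> s < x \<and> x < \<beta> s \<and> dist s t < min d t) (at_left t)"
    by (simp add: eventually_at_split)
  moreover have "eventually (\<lambda>s. s < t) (at_left t)"
    by (simp add: eventually_at_filter)
  ultimately have "eventually (\<lambda>s. \<alpha> s < x \<and> x < \<beta> s \<and> dist s t < min d t \<and> s < t) (at_left t)"
    by eventually_elim auto
  then obtain s where s: "\<alpha> s < x" "x < \<beta> s" "dist s t < min d t" "s < t"
    using eventually_happens[of _ "at_left t"] by (auto simp: trivial_limit_at_left_real)
  have "V x t < V x (t - (t - s))"
    using s by (intro d(2)) (auto simp: dist_real_def)
  moreover have "V x s \<le> V x t"
    using s tx by (intro mx) (auto simp: dist_real_def)
  ultimately show False by simp
qed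

section \<open>The extremal functions\<close>

text \<open>The supremum changes by at most \<open>\<bar>\<Delta>p\<bar> + \<bar>\<Delta>q\<bar>\<close> when the coefficients change by \<open>\<Delta>p\<close> and \<open>\<Delta>q\<close>.\<close>

lemma continuous_on_SUP_quadratic:
  fixes p q :: "real \<Rightarrow> real"
  assumes "continuous_on S p" and "continuous_on S q"
  shows "continuous_on S (\<lambda>t. SUP \<eta>\<in>{0..1}. \<eta>\<^sup>2 * p t + \<eta> * q t)"
proof -
  let ?M = "\<lambda>t. SUP \<eta>\<in>{0..1}. \<eta>\<^sup>2 * p t + \<eta> * q t"
  have bdd: "bdd_above ((\<lambda>\<eta>. \<eta>\<^sup>2 * p t + \<eta> * q t) ` {0..1})" for t
    by (intro bounded_imp_bdd_above compact_imp_bounded compact_continuous_image continuous_intros) auto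
  have le: "?M t \<le> ?M s + (\<bar>p t - p s\<bar> + \<bar>q t - q s\<bar>)" for s t
  proof (rule cSUP_least)
    fix \<eta> :: real assume \<eta>: "\<eta> \<in> {0..1}"
    have "\<eta>\<^sup>2 * (p t - p s) \<le> \<bar>p t - p s\<bar>" "\<eta> * (q t - q s) \<le> \<bar>q t - q s\<bar>"
      using \<eta> by (intro order_trans[OF mult_left_mono[OF abs_ge_self] mult_left_le_one_le];
        simp add: power_le_one)+
    moreover have "\<eta>\<^sup>2 * p s + \<eta> * q s \<le> ?M s"
      using \<eta> bdd by (intro cSUP_upper)
    ultimately show "\<eta>\<^sup>2 * p t + \<eta> * q t \<le> ?M s + (\<bar>p t - p s\<bar> + \<bar>q t - q s\<bar>)"
      by (simp add: algebra_simps)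
  qed simp
  show ?thesis
    unfolding continuous_on_def
  proof
    fix s assume s: "s \<in> S"
    have "((\<lambda>t. \<bar>p t - p s\<bar> + \<bar>q t - q s\<bar>) \<longlongrightarrow> \<bar>p s - p s\<bar> + \<bar>q s - q s\<bar>) (at s within S)"
      using assms s by (intro tendsto_intros) (auto simp: continuous_on_def)
    then have *: "((\<lambda>t. \<bar>p t - p s\<bar> + \<bar>q t - q s\<bar>) \<longlongrightarrow> 0) (at s within S)" by simp
    show "(?M \<longlongrightarrow> ?M s) (at s within S)"
    proof (rule real_tendsto_sandwich)
      show "((\<lambda>t. ?M s - (\<bar>p t - p s\<bar> + \<bar>q t - q s\<bar>)) \<longlongrightarrow> ?M s) (at s within S)"
        using tendsto_diff[OF tendsto_const *, of "?M s"] by simp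
      show "((\<lambda>t. ?M s + (\<bar>p t - p s\<bar> + \<bar>q t - q s\<bar>)) \<longlongrightarrow> ?M s) (at s within S)"
        using tendsto_add[OF tendsto_const *, of "?M s"] by simp
      show "\<forall>\<^sub>F t in at s within S. ?M s - (\<bar>p t - p s\<bar> + \<bar>q t - q s\<bar>) \<le> ?M t"
        using le[of s] by (intro always_eventually) (simp add: algebra_simps abs_minus_commute)
      show "\<forall>\<^sub>F t in at s within S. ?M t \<le> ?M s + (\<bar>p t - p s\<bar> + \<bar>q t - q s\<bar>)"
        using le by (intro always_eventually) simp
    qed
  qed
qed

lemma continuous_on_Q_upper:
  assumes "continuous_on S A2" "continuous_on S L" "continuous_on S L2"
  shows "continuous_on S (Q_upper A2 L L2)"
proof -
  have "continuous_on S (\<lambda>t. SUP \<eta>\<in>{0..1}. \<eta>\<^sup>2 * (L2 t * L t / 2) + \<eta> * (A2 t * L t))"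
    by (intro continuous_on_SUP_quadratic continuous_intros assms) auto
  moreover have "Q_upper A2 L L2 = (\<lambda>t. SUP \<eta>\<in>{0..1}. \<eta>\<^sup>2 * (L2 t * L t / 2) + \<eta> * (A2 t * L t))"
    by (simp add: fun_eq_iff Q_upper_def mult.assoc)
  ultimately show ?thesis by simp
qed

lemma Q_lower_eq_Q_upper:
  "Q_lower A2 L L2 = Q_upper (\<lambda>t. - A2 t) L (\<lambda>t. - L2 t)"
  by (simp add: fun_eq_iff Q_lower_def Q_upper_def Inf_real_def image_image)

lemma le_Q_upper:
  assumes "0 \<le> \<eta>" "\<eta> \<le> 1"
  shows "\<eta>\<^sup>2 * L2 t * L t / 2 + \<eta> * A2 t * L t \<le> Q_upper A2 L L2 t"
  unfolding Q_upper_def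
proof (rule cSUP_upper)
  show "bdd_above ((\<lambda>\<eta>. \<eta>\<^sup>2 * L2 t * L t / 2 + \<eta> * A2 t * L t) ` {0..1})"
    by (intro bounded_imp_bdd_above compact_imp_bounded compact_continuous_image continuous_intros) auto
qed (use assms in auto)

lemma ge_minus_Q_lower:
  assumes "0 \<le> \<eta>" "\<eta> \<le> 1"
  shows "- Q_lower A2 L L2 t \<le> \<eta>\<^sup>2 * L2 t * L t / 2 + \<eta> * A2 t * L t"
  using le_Q_upper[OF assms, of "\<lambda>t. - L2 t" t L "\<lambda>t. - A2 t"] by (simp add: Q_lower_eq_Q_upper)

section \<open>The barrier\<close>

lemma integral_has_real_derivative_halfline:
  fixes g :: "real \<Rightarrow> real"
  assumes "continuous_on {0..} g" and "t \<ge> 0"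
  shows "((\<lambda>s. integral {0..s} g) has_real_derivative g t) (at t within {0..})"
proof -
  have "((\<lambda>s. integral {0..s} g) has_real_derivative g t) (at t within {0..t + 1})"
    using assms by (intro integral_has_real_derivative continuous_on_subset[OF assms(1)]) auto
  moreover have "at t within {0..t + 1} = at t within {0..}"
    by (rule at_within_nhd[of t "{..<t + 1}"]) auto
  ultimately show ?thesis by simp
qed

text \<open>The exponent of the barrier at the point \<open>x\<close> of the moving interval. With
  \<open>\<xi> = (x - A t) L0 / L t\<close>, the last two terms are those of the change of variables from \<open>u\<close> to \<open>w\<close>.
  The factor \<open>sqrt (L0 / L t)\<close> is absorbed as \<open>ln (L0 / L t) / 2\<close>, so that every derivative of the
  barrier is the exponential times a combination of a sine and a cosine.\<close>

definition barrier_exponent ::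
  "real \<Rightarrow> real \<Rightarrow> real \<Rightarrow> (real \<Rightarrow> real) \<Rightarrow> (real \<Rightarrow> real) \<Rightarrow> (real \<Rightarrow> real) \<Rightarrow> (real \<Rightarrow> real) \<Rightarrow>
   (real \<Rightarrow> real) \<Rightarrow> real \<Rightarrow> real \<Rightarrow> real" where
  "barrier_exponent D r L0 A A1 L L1 q x t =
     ln (L0 / L t) / 2 + (r * t - integral {0..t} (\<lambda>\<zeta>. (A1 \<zeta>)\<^sup>2 / (4 * D)))
     + integral {0..t} (\<lambda>\<zeta>. - (D * pi\<^sup>2 / (L \<zeta>)\<^sup>2) + q \<zeta> / (2 * D))
     - (x - A t)\<^sup>2 * L1 t / (4 * D * L t) - (x - A t) * A1 t / (2 * D)"

text \<open>The barrier, normalised to have coefficient \<open>1\<close> in front of the sine. It depends on a function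
  \<open>q\<close> that takes the values \<open>Q_upper\<close> and \<open>- Q_lower\<close> in the two comparisons.\<close>

definition barrier ::
  "real \<Rightarrow> real \<Rightarrow> real \<Rightarrow> (real \<Rightarrow> real) \<Rightarrow> (real \<Rightarrow> real) \<Rightarrow> (real \<Rightarrow> real) \<Rightarrow> (real \<Rightarrow> real) \<Rightarrow>
   (real \<Rightarrow> real) \<Rightarrow> real \<Rightarrow> real \<Rightarrow> real" where
  "barrier D r L0 A A1 L L1 q x t =
     sin (pi * (x - A t) / L t) * exp (barrier_exponent D r L0 A A1 L L1 q x t)"

lemma C2_on_halfline_continuous:
  assumes "C2_on_halfline f f1 f2"
  shows "continuous_on {0..} f" "continuous_on {0..} f1" "continuous_on {0..} f2"
  using assms unfolding C2_on_halfline_def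
  by (auto intro!: DERIV_continuous_on)

lemma C2_on_halfline_deriv:
  assumes "C2_on_halfline f f1 f2" and "t > 0"
  shows "(f has_real_derivative f1 t) (at t)" "(f1 has_real_derivative f2 t) (at t)"
proof -
  have "at t within {0..} = at t"
    by (rule at_within_interior) (use \<open>t > 0\<close> in simp)
  then show "(f has_real_derivative f1 t) (at t)" "(f1 has_real_derivative f2 t) (at t)"
    using assms unfolding C2_on_halfline_def by (metis less_imp_le)+
qed

text \<open>The exponent is chosen so that the cosine terms of \<open>\<Phi>t\<close> and \<open>D * \<Phi>xx\<close> cancel, and so that
  the sine terms differ only by \<open>r\<close> and by the gap between \<open>q\<close> and the quadratic in
  \<open>\<eta> = (x - A t) / L t\<close>.\<close>

lemma barrier_pde:
  fixes A A1 A2 L L1 L2 q :: "real \<Rightarrow> real"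
  assumes "D > 0" "L0 > 0"
    and A: "C2_on_halfline A A1 A2" and L: "C2_on_halfline L L1 L2"
    and Lpos: "\<And>t. t \<ge> 0 \<Longrightarrow> L t > 0"
    and q: "continuous_on {0..} q"
  obtains \<Phi>t \<Phi>x \<Phi>xx where
    "\<And>x t. t > 0 \<Longrightarrow> ((\<lambda>s. barrier D r L0 A A1 L L1 q x s) has_real_derivative \<Phi>t x t) (at t)"
    "\<And>x t. t > 0 \<Longrightarrow> ((\<lambda>y. barrier D r L0 A A1 L L1 q y t) has_real_derivative \<Phi>x x t) (at x)"
    "\<And>x t. t > 0 \<Longrightarrow> ((\<lambda>y. \<Phi>x y t) has_real_derivative \<Phi>xx x t) (at x)"
    "\<And>x t. t > 0 \<Longrightarrow> \<Phi>t x t = D * \<Phi>xx x t + r * barrier D r L0 A A1 L L1 q x t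
       + (q t - (((x - A t) / L t)\<^sup>2 * L2 t * L t / 2 + (x - A t) / L t * A2 t * L t)) / (2 * D)
         * barrier D r L0 A A1 L L1 q x t"
proof -
  let ?E = "barrier_exponent D r L0 A A1 L L1 q"
  let ?\<theta> = "\<lambda>x t. pi * (x - A t) / L t"
  define \<theta>t where "\<theta>t x t = - pi * A1 t / L t - pi * (x - A t) * L1 t / (L t)\<^sup>2" for x t
  define Ex where "Ex x t = - (x - A t) * L1 t / (2 * D * L t) - A1 t / (2 * D)" for x t
  define Exx where "Exx t = - L1 t / (2 * D * L t)" for t
  define Et where "Et x t = - L1 t / (2 * L t)
      + (r - (A1 t)\<^sup>2 / (4 * D) - D * pi\<^sup>2 / (L t)\<^sup>2 + q t / (2 * D))
      + (x - A t) * A1 t * L1 t / (2 * D * L t) - (x - A t)\<^sup>2 * L2 t / (4 * D * L t)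
      + (x - A t)\<^sup>2 * (L1 t)\<^sup>2 / (4 * D * (L t)\<^sup>2) + (A1 t)\<^sup>2 / (2 * D) - (x - A t) * A2 t / (2 * D)" for x t
  define \<Phi>t where "\<Phi>t x t = (\<theta>t x t * cos (?\<theta> x t) + Et x t * sin (?\<theta> x t)) * exp (?E x t)" for x t
  define \<Phi>x where "\<Phi>x x t = (pi / L t * cos (?\<theta> x t) + Ex x t * sin (?\<theta> x t)) * exp (?E x t)" for x t
  define \<Phi>xx where "\<Phi>xx x t = (2 * (pi / L t) * Ex x t * cos (?\<theta> x t)
      + (Exx t + (Ex x t)\<^sup>2 - (pi / L t)\<^sup>2) * sin (?\<theta> x t)) * exp (?E x t)" for x t
  have *: "((\<lambda>s. barrier D r L0 A A1 L L1 q x s) has_real_derivative \<Phi>t x t) (at t) \<and>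
    ((\<lambda>y. barrier D r L0 A A1 L L1 q y t) has_real_derivative \<Phi>x x t) (at x) \<and>
    ((\<lambda>y. \<Phi>x y t) has_real_derivative \<Phi>xx x t) (at x) \<and>
    \<Phi>t x t = D * \<Phi>xx x t + r * barrier D r L0 A A1 L L1 q x t
       + (q t - (((x - A t) / L t)\<^sup>2 * L2 t * L t / 2 + (x - A t) / L t * A2 t * L t)) / (2 * D)
         * barrier D r L0 A A1 L L1 q x t"
    if t: "t > 0" for x t
  proof (intro conjI)
    have Lt: "L t > 0" using Lpos t by simp
    note dA = C2_on_halfline_deriv[OF A t] and dL = C2_on_halfline_deriv[OF L t]
    note cA = C2_on_halfline_continuous[OF A] and cL = C2_on_halfline_continuous[OF L]
    have int: "((\<lambda>s. integral {0..s} g) has_real_derivative g t) (at t)"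
      if "continuous_on {0..} g" for g :: "real \<Rightarrow> real"
      using integral_has_real_derivative_halfline[OF that, of t] t at_within_interior[of t "{0..}"] by simp
    define I1 where "I1 s = integral {0..s} (\<lambda>\<zeta>. (A1 \<zeta>)\<^sup>2 / (4 * D))" for s
    define I2 where "I2 s = integral {0..s} (\<lambda>\<zeta>. - (D * pi\<^sup>2 / (L \<zeta>)\<^sup>2) + q \<zeta> / (2 * D))" for s
    have i1: "(I1 has_real_derivative (A1 t)\<^sup>2 / (4 * D)) (at t)"
      unfolding I1_def using \<open>D > 0\<close> by (intro int continuous_intros cA) auto
    have i2: "(I2 has_real_derivative - (D * pi\<^sup>2 / (L t)\<^sup>2) + q t / (2 * D)) (at t)"
      unfolding I2_def using \<open>D > 0\<close> Lpos by (intro int continuous_intros cL q) (auto simp: less_imp_neq[THEN not_sym])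
    have dEt: "((\<lambda>s. ?E x s) has_real_derivative Et x t) (at t)"
      unfolding barrier_exponent_def I1_def[symmetric] I2_def[symmetric] Et_def using Lt \<open>D > 0\<close> \<open>L0 > 0\<close>
      by (auto intro!: derivative_eq_intros dA dL i1 i2)
         (simp add: field_simps power2_eq_square)
    have d\<theta>t: "((\<lambda>s. ?\<theta> x s) has_real_derivative \<theta>t x t) (at t)"
      unfolding \<theta>t_def using Lt
      by (auto intro!: derivative_eq_intros dA dL simp: field_simps power2_eq_square)
    have dEx: "((\<lambda>y. ?E y t) has_real_derivative Ex x t) (at x)" for x
      unfolding barrier_exponent_def Ex_def using Lt \<open>D > 0\<close>
      by (auto intro!: derivative_eq_intros simp: field_simps)
    have dExx: "((\<lambda>y. Ex y t) has_real_derivative Exx t) (at x)"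
      unfolding Exx_def Ex_def using Lt \<open>D > 0\<close>
      by (auto intro!: derivative_eq_intros simp: field_simps)
    have d\<theta>x: "((\<lambda>y. ?\<theta> y t) has_real_derivative pi / L t) (at x)" for x
      using Lt by (auto intro!: derivative_eq_intros simp: field_simps)
    show "((\<lambda>s. barrier D r L0 A A1 L L1 q x s) has_real_derivative \<Phi>t x t) (at t)"
      unfolding barrier_def \<Phi>t_def
      by (rule derivative_eq_intros dEt d\<theta>t refl | simp add: algebra_simps)+
    show "((\<lambda>y. barrier D r L0 A A1 L L1 q y t) has_real_derivative \<Phi>x x t) (at x)"
      unfolding barrier_def \<Phi>x_def
      by (rule derivative_eq_intros dEx d\<theta>x refl | simp add: algebra_simps)+
    have "((\<lambda>y. \<Phi>x y t) has_real_derivative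
        (pi / L t * (- sin (?\<theta> x t) * (pi / L t)) + (Exx t * sin (?\<theta> x t) + cos (?\<theta> x t) * (pi / L t) * Ex x t))
          * exp (?E x t)
        + exp (?E x t) * Ex x t * (pi / L t * cos (?\<theta> x t) + Ex x t * sin (?\<theta> x t))) (at x)"
      unfolding \<Phi>x_def
      by (intro DERIV_mult' DERIV_mult DERIV_add DERIV_cmult DERIV_fun_exp DERIV_fun_sin DERIV_fun_cos
          dEx dExx d\<theta>x DERIV_chain2[OF DERIV_exp] DERIV_chain2[OF DERIV_sin] DERIV_chain2[OF DERIV_cos])
    then show "((\<lambda>y. \<Phi>x y t) has_real_derivative \<Phi>xx x t) (at x)"
      by (rule DERIV_cong) (simp add: \<Phi>xx_def algebra_simps power2_eq_square)
    \<comment> \<open>The coefficients of the cosine, then those of the sine.\<close>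
    have c: "\<theta>t x t = D * (2 * (pi / L t) * Ex x t)"
      unfolding \<theta>t_def Ex_def using Lt \<open>D > 0\<close> by (simp add: field_simps power2_eq_square)
    have s: "Et x t = D * (Exx t + (Ex x t)\<^sup>2 - (pi / L t)\<^sup>2) + r
        + (q t - (((x - A t) / L t)\<^sup>2 * L2 t * L t / 2 + (x - A t) / L t * A2 t * L t)) / (2 * D)"
      unfolding Et_def Exx_def Ex_def using Lt \<open>D > 0\<close> by (simp add: field_simps power2_eq_square)
    show "\<Phi>t x t = D * \<Phi>xx x t + r * barrier D r L0 A A1 L L1 q x t
         + (q t - (((x - A t) / L t)\<^sup>2 * L2 t * L t / 2 + (x - A t) / L t * A2 t * L t)) / (2 * D)
           * barrier D r L0 A A1 L L1 q x t"
      unfolding \<Phi>t_def \<Phi>xx_def barrier_def c s by (simp add: algebra_simps)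
  qed
  show thesis
    by (rule that[of \<Phi>t \<Phi>x \<Phi>xx])
      (erule *[THEN conjunct1] *[THEN conjunct2, THEN conjunct1]
        *[THEN conjunct2, THEN conjunct2, THEN conjunct1] *[THEN conjunct2, THEN conjunct2, THEN conjunct2])+
qed

lemma continuous_on_barrier:
  fixes A A1 A2 L L1 L2 q :: "real \<Rightarrow> real"
  assumes "D > 0" "L0 > 0"
    and A: "C2_on_halfline A A1 A2" and L: "C2_on_halfline L L1 L2"
    and Lpos: "\<And>t. t \<ge> 0 \<Longrightarrow> L t > 0"
    and q: "continuous_on {0..} q"
  shows "continuous_on (UNIV \<times> {0..}) (\<lambda>(x, t). barrier D r L0 A A1 L L1 q x t)"
proof -
  note cA = C2_on_halfline_continuous[OF A] and cL = C2_on_halfline_continuous[OF L]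
  have snd: "continuous_on (UNIV \<times> {0..}) (\<lambda>p::real \<times> real. g (snd p))"
    if "continuous_on {0..} g" for g :: "real \<Rightarrow> real"
    by (rule continuous_on_compose2[OF that]) (auto intro: continuous_intros)
  have int: "continuous_on {0..} (\<lambda>s. integral {0..s} g)"
    if "continuous_on {0..} g" for g :: "real \<Rightarrow> real"
    using integral_has_real_derivative_halfline[OF that] by (auto intro: DERIV_continuous_on)
  have L0: "L t \<noteq> 0" if "t \<ge> 0" for t using Lpos[OF that] by simp
  have i1: "continuous_on {0..} (\<lambda>s. integral {0..s} (\<lambda>\<zeta>. (A1 \<zeta>)\<^sup>2 / (4 * D)))"
    using \<open>D > 0\<close> by (intro int continuous_intros cA) auto
  have i2: "continuous_on {0..} (\<lambda>s. integral {0..s} (\<lambda>\<zeta>. - (D * pi\<^sup>2 / (L \<zeta>)\<^sup>2) + q \<zeta> / (2 * D)))"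
    using \<open>D > 0\<close> L0 by (intro int continuous_intros cL q) auto
  have ln: "continuous_on {0..} (\<lambda>t. ln (L0 / L t))"
    using L0 \<open>L0 > 0\<close> by (intro continuous_intros cL) auto
  show ?thesis
    unfolding barrier_def barrier_exponent_def case_prod_beta using \<open>D > 0\<close> L0
    by (intro continuous_intros snd[OF i1] snd[OF i2] snd[OF ln] snd[OF cA(1)] snd[OF cA(2)]
        snd[OF cL(1)] snd[OF cL(2)]) auto
qed

section \<open>Two-sided bounds for the solution\<close>

theorem theorem2p1:
  fixes D r L0 a b :: real
    and A A1 A2 L L1 L2 :: "real \<Rightarrow> real"
    and \<psi> u w :: "real \<Rightarrow> real \<Rightarrow> real"
  assumes "D > 0" and "r > 0" and "L0 > 0"
    and "C2_on_halfline A A1 A2"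
    and "C2_on_halfline L L1 L2"
    and "\<And>t. t \<ge> 0 \<Longrightarrow> L t > 0"
    and "linear_dirichlet_solution D r A L \<psi>"
    and "\<And>x t. t \<ge> 0 \<Longrightarrow> A t \<le> x \<Longrightarrow> x \<le> A t + L t \<Longrightarrow> \<psi> x t \<ge> 0"
    and "\<And>x t. t \<ge> 0 \<Longrightarrow> A t \<le> x \<Longrightarrow> x \<le> A t + L t \<Longrightarrow>
           \<psi> x t = u ((x - A t) / L t * L0) t"
    and "\<And>\<xi> t. t \<ge> 0 \<Longrightarrow> 0 \<le> \<xi> \<Longrightarrow> \<xi> \<le> L0 \<Longrightarrow>
           w \<xi> t = w_transform D r L0 A1 L L1 u \<xi> t"
    and "0 < b" and "b \<le> a"
    and "\<And>\<xi>. 0 \<le> \<xi> \<Longrightarrow> \<xi> \<le> L0 \<Longrightarrow>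
           b * sin (pi * \<xi> / L0) \<le> w \<xi> 0 \<and> w \<xi> 0 \<le> a * sin (pi * \<xi> / L0)"
  shows "\<forall>t\<ge>0. \<forall>\<xi>\<in>{0..L0}.
     u \<xi> t \<ge> b * sin (pi * \<xi> / L0) * sqrt (L0 / L t)
        * exp (r * t - integral {0..t} (\<lambda>\<zeta>. (A1 \<zeta>)\<^sup>2 / (4 * D)))
        * exp (integral {0..t} (\<lambda>\<zeta>. - (D * pi\<^sup>2 / (L \<zeta>)\<^sup>2) - Q_lower A2 L L2 \<zeta> / (2 * D))
               - \<xi>\<^sup>2 * L1 t * L t / (4 * D * L0\<^sup>2) - \<xi> * A1 t * L t / (2 * D * L0))
     \<and> u \<xi> t \<le> a * sin (pi * \<xi> / L0) * sqrt (L0 / L t)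
        * exp (r * t - integral {0..t} (\<lambda>\<zeta>. (A1 \<zeta>)\<^sup>2 / (4 * D)))
        * exp (integral {0..t} (\<lambda>\<zeta>. - (D * pi\<^sup>2 / (L \<zeta>)\<^sup>2) + Q_upper A2 L L2 \<zeta> / (2 * D))
               - \<xi>\<^sup>2 * L1 t * L t / (4 * D * L0\<^sup>2) - \<xi> * A1 t * L t / (2 * D * L0))"
proof (intro allI impI ballI)
  fix t \<xi> :: real assume t: "0 \<le> t" and \<xi>: "\<xi> \<in> {0..L0}"
  note A = assms(4) and L = assms(5) and Lpos = assms(6) and \<psi>u = assms(9) and w = assms(10)
  note sol = assms(7)[unfolded linear_dirichlet_solution_def]
  let ?\<Phi> = "barrier D r L0 A A1 L L1"
  let ?\<Omega> = "{(x, t). 0 \<le> t \<and> A t \<le> x \<and> x \<le> A t + L t}"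
  let ?F = "\<lambda>x t. ((x - A t) / L t)\<^sup>2 * L2 t * L t / 2 + (x - A t) / L t * A2 t * L t"
  note cA = C2_on_halfline_continuous[OF A] and cL = C2_on_halfline_continuous[OF L]
  obtain \<psi>t \<psi>x \<psi>xx where \<psi>': "\<forall>t>0. \<forall>x\<in>{A t<..<A t + L t}.
        ((\<lambda>s. \<psi> x s) has_real_derivative \<psi>t x t) (at t) \<and>
        ((\<lambda>y. \<psi> y t) has_real_derivative \<psi>x x t) (at x) \<and>
        ((\<lambda>y. \<psi>x y t) has_real_derivative \<psi>xx x t) (at x) \<and>
        \<psi>t x t = D * \<psi>xx x t + r * \<psi> x t"
    using sol by blast
  have \<psi>: "((\<lambda>s. \<psi> x s) has_real_derivative \<psi>t x t) (at t)"
    "((\<lambda>y. \<psi> y t) has_real_derivative \<psi>x x t) (at x)"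
    "((\<lambda>y. \<psi>x y t) has_real_derivative \<psi>xx x t) (at x)"
    "\<psi>t x t = D * \<psi>xx x t + r * \<psi> x t"
    if "0 < t" "A t < x" "x < A t + L t" for x t
  proof -
    have "x \<in> {A t<..<A t + L t}" using that by simp
    with \<psi>' \<open>0 < t\<close> show "((\<lambda>s. \<psi> x s) has_real_derivative \<psi>t x t) (at t)"
      "((\<lambda>y. \<psi> y t) has_real_derivative \<psi>x x t) (at x)"
      "((\<lambda>y. \<psi>x y t) has_real_derivative \<psi>xx x t) (at x)"
      "\<psi>t x t = D * \<psi>xx x t + r * \<psi> x t"
      by blast+
  qed
  have \<psi>0: "\<psi> (A t) t = 0" "\<psi> (A t + L t) t = 0" if "0 \<le> t" for t
    using sol that by auto
  have c\<psi>: "continuous_on ?\<Omega> (\<lambda>(x, t). \<psi> x t)" using sol by simp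
  have cAL: "continuous_on {0..} (\<lambda>t. A t + L t)"
    by (intro continuous_intros cA cL)
  have \<Phi>_lat: "?\<Phi> q (A t) t = 0" "?\<Phi> q (A t + L t) t = 0" if "0 \<le> t" for q t
    using Lpos[OF that] by (auto simp: barrier_def)
  have \<Phi>_nonneg: "0 \<le> ?\<Phi> q x t" if "0 \<le> t" "A t \<le> x" "x \<le> A t + L t" for q x t
  proof -
    have "0 \<le> pi * ((x - A t) / L t)" "pi * ((x - A t) / L t) \<le> pi * 1"
      using Lpos[OF that(1)] that by (intro mult_nonneg_nonneg mult_left_mono; simp add: divide_le_eq_1)+
    then show ?thesis by (simp add: barrier_def sin_ge_zero)
  qed
  have \<eta>: "0 \<le> (x - A t) / L t" "(x - A t) / L t \<le> 1"
    if "0 < t" "A t < x" "x < A t + L t" for x t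
    using that Lpos[of t] by (auto simp: divide_le_eq_1)
  have c\<Phi>: "continuous_on ?\<Omega> (\<lambda>(x, t). ?\<Phi> q x t)" if "continuous_on {0..} q" for q
    by (rule continuous_on_subset[OF continuous_on_barrier[OF assms(1,3) A L Lpos that]]) auto

  define x where "x = A t + \<xi> * L t / L0"
  have x: "A t \<le> x" "x \<le> A t + L t"
    using \<xi> \<open>L0 > 0\<close> Lpos[OF t] by (auto simp: x_def field_simps mult_right_mono)
  have \<xi>x: "(x - A t) / L t * L0 = \<xi>"
    using Lpos[OF t] \<open>L0 > 0\<close> by (simp add: x_def)
  have \<psi>x: "\<psi> x t = u \<xi> t" using \<psi>u[OF t x] \<xi>x by simp
  have exp_ln: "exp (ln (L0 / L t) / 2) = sqrt (L0 / L t)" if "0 \<le> t" for t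
    using Lpos[OF that] \<open>L0 > 0\<close> by (simp add: powr_half_sqrt[symmetric] powr_def)
  have \<Phi>_eq: "?\<Phi> q x t = sin (pi * \<xi> / L0) * sqrt (L0 / L t)
        * exp (r * t - integral {0..t} (\<lambda>\<zeta>. (A1 \<zeta>)\<^sup>2 / (4 * D)))
        * exp (integral {0..t} (\<lambda>\<zeta>. - (D * pi\<^sup>2 / (L \<zeta>)\<^sup>2) + q \<zeta> / (2 * D))
               - \<xi>\<^sup>2 * L1 t * L t / (4 * D * L0\<^sup>2) - \<xi> * A1 t * L t / (2 * D * L0))"
    if "0 \<le> t" "x = A t + \<xi> * L t / L0" for q x t \<xi>
  proof -
    have y: "x - A t = \<xi> * L t / L0" using that(2) by simp
    have "pi * (x - A t) / L t = pi * \<xi> / L0"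
      "(x - A t)\<^sup>2 * L1 t / (4 * D * L t) = \<xi>\<^sup>2 * L1 t * L t / (4 * D * L0\<^sup>2)"
      "(x - A t) * A1 t / (2 * D) = \<xi> * A1 t * L t / (2 * D * L0)"
      unfolding y using Lpos[OF that(1)] \<open>L0 > 0\<close> \<open>D > 0\<close> by (auto simp: field_simps power2_eq_square)
    then show ?thesis
      unfolding barrier_def barrier_exponent_def exp_ln[OF that(1), symmetric]
      by (simp add: exp_add[symmetric] exp_diff[symmetric] mult.assoc add.assoc add_diff_eq)
  qed
  \<comment> \<open>At time \<open>0\<close> all integrals vanish, so the barrier does not depend on \<open>q\<close>, and \<open>w\<close> and the sine
    arise from \<open>\<psi>\<close> and the barrier by multiplication with the same positive factor \<open>k\<close>.\<close>
  have init: "b * ?\<Phi> q x 0 \<le> \<psi> x 0 \<and> \<psi> x 0 \<le> a * ?\<Phi> q x 0" if x: "A 0 \<le> x" "x \<le> A 0 + L 0" for q x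
  proof -
    have L0: "L 0 > 0" using Lpos by simp
    define \<xi> where "\<xi> = (x - A 0) / L 0 * L0"
    have x\<xi>: "x = A 0 + \<xi> * L 0 / L0" using L0 \<open>L0 > 0\<close> by (simp add: \<xi>_def)
    have \<xi>: "0 \<le> \<xi>" "\<xi> \<le> L0"
      unfolding \<xi>_def using x L0 \<open>L0 > 0\<close>
      by (intro mult_nonneg_nonneg mult_left_le_one_le; simp add: divide_le_eq_1)+
    define k where "k = sqrt (L 0 / L0) * exp (\<xi>\<^sup>2 * L1 0 * L 0 / (4 * D * L0\<^sup>2) + \<xi> * A1 0 * L 0 / (2 * D * L0))"
    have k: "k > 0" using L0 \<open>L0 > 0\<close> by (simp add: k_def)
    have "w \<xi> 0 = \<psi> x 0 * k"
      using w[of 0 \<xi>] \<xi> \<psi>u[of 0 x] x by (simp add: w_transform_def k_def \<xi>_def)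
    moreover have "?\<Phi> q x 0 * k = sin (pi * \<xi> / L0)"
      unfolding \<Phi>_eq[OF order_refl x\<xi>] k_def using L0 \<open>L0 > 0\<close>
      by (simp add: real_sqrt_divide exp_add exp_diff exp_minus field_simps)
    ultimately have "b * ?\<Phi> q x 0 * k \<le> \<psi> x 0 * k \<and> \<psi> x 0 * k \<le> a * ?\<Phi> q x 0 * k"
      using assms(13)[OF \<xi>] by (simp add: mult.assoc)
    then show ?thesis using k by (simp del: mult_cancel_right)
  qed

  have "\<psi> x t - a * ?\<Phi> (Q_upper A2 L L2) x t \<le> 0"
  proof -
    let ?q = "Q_upper A2 L L2"
    have q: "continuous_on {0..} ?q" by (intro continuous_on_Q_upper cA cL)
    obtain \<Phi>t \<Phi>x \<Phi>xx where \<Phi>: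
      "\<And>x t. t > 0 \<Longrightarrow> ((\<lambda>s. ?\<Phi> ?q x s) has_real_derivative \<Phi>t x t) (at t)"
      "\<And>x t. t > 0 \<Longrightarrow> ((\<lambda>y. ?\<Phi> ?q y t) has_real_derivative \<Phi>x x t) (at x)"
      "\<And>x t. t > 0 \<Longrightarrow> ((\<lambda>y. \<Phi>x y t) has_real_derivative \<Phi>xx x t) (at x)"
      "\<And>x t. t > 0 \<Longrightarrow> \<Phi>t x t = D * \<Phi>xx x t + r * ?\<Phi> ?q x t + (?q t - ?F x t) / (2 * D) * ?\<Phi> ?q x t"
      using barrier_pde[OF assms(1,3) A L Lpos q, where r = r] by blast
    show ?thesis
    proof (rule weak_maximum_principle_moving_interval[where D = D and r = r and \<alpha> = A and \<beta> = "\<lambda>t. A t + L t"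
          and v = "\<lambda>x t. \<psi> x t - a * ?\<Phi> ?q x t" and vt = "\<lambda>x t. \<psi>t x t - a * \<Phi>t x t"
          and vx = "\<lambda>x t. \<psi>x x t - a * \<Phi>x x t" and vxx = "\<lambda>x t. \<psi>xx x t - a * \<Phi>xx x t"])
      show "continuous_on ?\<Omega> (\<lambda>(x, t). \<psi> x t - a * ?\<Phi> ?q x t)"
        using c\<psi> c\<Phi>[OF q] unfolding case_prod_beta by (intro continuous_intros)
      show "\<psi>t x t - a * \<Phi>t x t \<le> D * (\<psi>xx x t - a * \<Phi>xx x t) + r * (\<psi> x t - a * ?\<Phi> ?q x t)"
        if x: "0 < t" "A t < x" "x < A t + L t" for x t
      proof -
        have "0 \<le> a * ((?q t - ?F x t) / (2 * D) * ?\<Phi> ?q x t)"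
          using le_Q_upper[OF \<eta>[OF x], of L2 t L A2] \<Phi>_nonneg[of t x ?q] x assms(1,11,12)
          by (intro mult_nonneg_nonneg divide_nonneg_pos) auto
        then show ?thesis
          unfolding \<psi>(4)[OF x] \<Phi>(4)[OF x(1)] by (simp add: ring_distribs)
      qed
      show "\<psi> x 0 - a * ?\<Phi> ?q x 0 \<le> 0" if "A 0 \<le> x" "x \<le> A 0 + L 0" for x
        using init[OF that] by simp
      show "\<psi> (A t) t - a * ?\<Phi> ?q (A t) t \<le> 0 \<and> \<psi> (A t + L t) t - a * ?\<Phi> ?q (A t + L t) t \<le> 0" if "0 \<le> t" for t
        using \<psi>0[OF that] \<Phi>_lat[OF that] by simp
    qed (use \<open>D > 0\<close> in \<open>simp_all add: cA cAL t x DERIV_diff DERIV_cmult \<psi>(1-3) \<Phi>(1-3)\<close>)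
  qed
  moreover have "b * ?\<Phi> (\<lambda>t. - Q_lower A2 L L2 t) x t - \<psi> x t \<le> 0"
  proof -
    let ?q = "\<lambda>t. - Q_lower A2 L L2 t"
    have q: "continuous_on {0..} ?q"
      unfolding Q_lower_eq_Q_upper by (intro continuous_on_Q_upper continuous_on_minus cA cL)
    obtain \<Phi>t \<Phi>x \<Phi>xx where \<Phi>:
      "\<And>x t. t > 0 \<Longrightarrow> ((\<lambda>s. ?\<Phi> ?q x s) has_real_derivative \<Phi>t x t) (at t)"
      "\<And>x t. t > 0 \<Longrightarrow> ((\<lambda>y. ?\<Phi> ?q y t) has_real_derivative \<Phi>x x t) (at x)"
      "\<And>x t. t > 0 \<Longrightarrow> ((\<lambda>y. \<Phi>x y t) has_real_derivative \<Phi>xx x t) (at x)"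
      "\<And>x t. t > 0 \<Longrightarrow> \<Phi>t x t = D * \<Phi>xx x t + r * ?\<Phi> ?q x t + (?q t - ?F x t) / (2 * D) * ?\<Phi> ?q x t"
      using barrier_pde[OF assms(1,3) A L Lpos q, where r = r] by blast
    show ?thesis
    proof (rule weak_maximum_principle_moving_interval[where D = D and r = r and \<alpha> = A and \<beta> = "\<lambda>t. A t + L t"
          and v = "\<lambda>x t. b * ?\<Phi> ?q x t - \<psi> x t" and vt = "\<lambda>x t. b * \<Phi>t x t - \<psi>t x t"
          and vx = "\<lambda>x t. b * \<Phi>x x t - \<psi>x x t" and vxx = "\<lambda>x t. b * \<Phi>xx x t - \<psi>xx x t"])
      show "continuous_on ?\<Omega> (\<lambda>(x, t). b * ?\<Phi> ?q x t - \<psi> x t)"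
        using c\<psi> c\<Phi>[OF q] unfolding case_prod_beta by (intro continuous_intros)
      show "b * \<Phi>t x t - \<psi>t x t \<le> D * (b * \<Phi>xx x t - \<psi>xx x t) + r * (b * ?\<Phi> ?q x t - \<psi> x t)"
        if x: "0 < t" "A t < x" "x < A t + L t" for x t
      proof -
        have "b * ((?q t - ?F x t) / (2 * D) * ?\<Phi> ?q x t) \<le> 0"
          using ge_minus_Q_lower[OF \<eta>[OF x], of A2 L L2 t] \<Phi>_nonneg[of t x ?q] x assms(1,11)
          by (intro mult_nonneg_nonpos mult_nonpos_nonneg divide_nonpos_pos) auto
        then show ?thesis
          unfolding \<psi>(4)[OF x] \<Phi>(4)[OF x(1)] by (simp add: ring_distribs)
      qed
      show "b * ?\<Phi> ?q x 0 - \<psi> x 0 \<le> 0" if "A 0 \<le> x" "x \<le> A 0 + L 0" for x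
        using init[OF that] by simp
      show "b * ?\<Phi> ?q (A t) t - \<psi> (A t) t \<le> 0 \<and> b * ?\<Phi> ?q (A t + L t) t - \<psi> (A t + L t) t \<le> 0" if "0 \<le> t" for t
        using \<psi>0[OF that] \<Phi>_lat[OF that] by simp
    qed (use \<open>D > 0\<close> in \<open>simp_all add: cA cAL t x DERIV_diff DERIV_cmult \<psi>(1-3) \<Phi>(1-3)\<close>)
  qed
  ultimately show "u \<xi> t \<ge> b * sin (pi * \<xi> / L0) * sqrt (L0 / L t)
        * exp (r * t - integral {0..t} (\<lambda>\<zeta>. (A1 \<zeta>)\<^sup>2 / (4 * D)))
        * exp (integral {0..t} (\<lambda>\<zeta>. - (D * pi\<^sup>2 / (L \<zeta>)\<^sup>2) - Q_lower A2 L L2 \<zeta> / (2 * D))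
               - \<xi>\<^sup>2 * L1 t * L t / (4 * D * L0\<^sup>2) - \<xi> * A1 t * L t / (2 * D * L0))
     \<and> u \<xi> t \<le> a * sin (pi * \<xi> / L0) * sqrt (L0 / L t)
        * exp (r * t - integral {0..t} (\<lambda>\<zeta>. (A1 \<zeta>)\<^sup>2 / (4 * D)))
        * exp (integral {0..t} (\<lambda>\<zeta>. - (D * pi\<^sup>2 / (L \<zeta>)\<^sup>2) + Q_upper A2 L L2 \<zeta> / (2 * D))
               - \<xi>\<^sup>2 * L1 t * L t / (4 * D * L0\<^sup>2) - \<xi> * A1 t * L t / (2 * D * L0))"
    unfolding \<Phi>_eq[OF t x_def] \<psi>x by (simp add: mult.assoc)
qed

end
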